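(* Every Sturmian word $\mathbf{s}$ satisfies $\mathrm{rep}(\mathbf{s})\le \sqrt{10}-\frac32$.
   Context: A Sturmian word is an infinite word $\mathbf{s}$ over a finite alphabet whose number $p(n,\mathbf{s})$ of distinct factors of length $n$ equals $n+1$ for every $n\ge1$. For an infinite word $\mathbf{x}=x_1x_2\ldots$, with $x_i^j=x_i\cdots x_j$, let $r(n,\mathbf{x})=\min\{m\ge1:\ x_i^{i+n-1}=x_{m-n+1}^{m}\text{ for some } 1\le i\le m-n\}$, and $\mathrm{rep}(\mathbf{x})=\liminf_{n\to\infty} r(n,\mathbf{x})/n$. *)

theory Defs
  imports "HOL-Analysis.Analysis"
begin

text \<open>Infinite words are functions nat => 'a, indexed from 0: the paper's letter x_k
is x (k - 1).  factor x j n is the factor of length n starting at (0-based) position j.\<close>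

definition factor :: "(nat \<Rightarrow> 'a) \<Rightarrow> nat \<Rightarrow> nat \<Rightarrow> 'a list" where
  "factor x j n = map (\<lambda>k. x (j + k)) [0..<n]"

definition complexity :: "nat \<Rightarrow> (nat \<Rightarrow> 'a) \<Rightarrow> nat" where
  "complexity n x = card {factor x j n | j. True}"

definition sturmian :: "(nat \<Rightarrow> 'a) \<Rightarrow> bool" where
  "sturmian s \<longleftrightarrow> finite (range s) \<and> (\<forall>n\<ge>1. complexity n s = n + 1)"

text \<open>r(n,x) = min{m >= 1 : x_i..x_{i+n-1} = x_{m-n+1}..x_m for some 1 <= i <= m-n}.
In 0-based indexing x_i..x_{i+n-1} is factor x (i-1) n and x_{m-n+1}..x_m is factor x (m-n) n.\<close>
definition rep_fun :: "nat \<Rightarrow> (nat \<Rightarrow> 'a) \<Rightarrow> nat" where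
  "rep_fun n x = (LEAST m. m \<ge> 1 \<and> (\<exists>i. 1 \<le> i \<and> i + n \<le> m \<and>
                     factor x (i - 1) n = factor x (m - n) n))"

definition rep :: "(nat \<Rightarrow> 'a) \<Rightarrow> ereal" where
  "rep x = Liminf sequentially (\<lambda>n. ereal (real (rep_fun n x) / real n))"

end

theory Submission
  imports Defs
begin

text \<open>
  Extend \<open>s\<close> to a two-sided word \<open>z\<close> with the same factors. A bispecial factor of length
  \<open>p + q - 2\<close> recurs with gaps \<open>p \<le> q\<close> only. One of the two gaps never occurs twice in a row,
  and merging it with the preceding gap leads to the next bispecial factor, with gaps
  \<open>(p, p + q)\<close> (type 1) or \<open>(q, p + q)\<close> (type 2).
  The first occurrence \<open>e \<ge> 0\<close> and the types of the gaps ending and starting there evolve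
  along, and each gap gives a repetition, hence an upper bound on \<open>rep_fun\<close>.

  If \<open>rep_fun n s > (1 + \<gamma>) n\<close> for all large \<open>n\<close> with \<open>\<gamma> > sqrt 10 - 5 / 2\<close>, these bounds are
  linear inequalities in \<open>p, q, e\<close> at every level. They force the gap ending in \<open>e\<close> to be long
  and the one starting in \<open>e\<close> to be short, and then force the periodic sequence of step types
  1, 2, 2, 2, i.e. a slope with eventual continued fraction period 2, 1, 1. Along this sequence the
  relevant repetitions satisfy the bound \<open>sqrt 10 - 5 / 2\<close> up to an additive constant, a contradiction.
\<close>

section \<open>Levels of a two-sided word\<close>

text \<open>
  A level describes the return words of a bispecial word \<open>w\<close> of length \<open>p + q - 2\<close>.
  The elements of \<open>S\<close> are occurrences of \<open>w\<close>; the letter \<open>a\<close> or \<open>b\<close> following an occurrence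
  tells whether the next one comes after \<open>p\<close> or \<open>q\<close> positions, and the same letter precedes that
  next occurrence.
\<close>

definition level :: "(int \<Rightarrow> 'a) \<Rightarrow> 'a \<Rightarrow> 'a \<Rightarrow> int \<Rightarrow> int \<Rightarrow> int set \<Rightarrow> bool" where
  "level z a b p q S \<longleftrightarrow> a \<noteq> b \<and> range z \<subseteq> {a, b} \<and> 0 < p \<and> 0 < q \<and>
     (\<forall>m\<in>S. \<forall>m'\<in>S. \<forall>i. 0 \<le> i \<and> i < p + q - 2 \<longrightarrow> z (m + i) = z (m' + i)) \<and>
     (\<forall>m\<in>S. z (m + (p + q - 2)) = a \<longrightarrow> m + p \<in> S \<and> z (m + p - 1) = a) \<and>
     (\<forall>m\<in>S. z (m + (p + q - 2)) = b \<longrightarrow> m + q \<in> S \<and> z (m + q - 1) = b) \<and>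
     (\<forall>m\<in>S. z (m - 1) = a \<longrightarrow> m - p \<in> S \<and> z (m - p + (p + q - 2)) = a) \<and>
     (\<forall>m\<in>S. z (m - 1) = b \<longrightarrow> m - q \<in> S \<and> z (m - q + (p + q - 2)) = b)"

lemma level_swap:
  assumes "level z a b p q S"
  shows "level z b a q p S"
  using assms unfolding level_def add.commute [of q p] insert_commute [of b a] by blast

lemma level_pos: "level z a b p q S \<Longrightarrow> 0 < p \<and> 0 < q \<and> a \<noteq> b"
  unfolding level_def by blast

lemma level_alphabet: "level z a b p q S \<Longrightarrow> z i = a \<or> z i = b"
  unfolding level_def by blast

lemma level_agree:
  "level z a b p q S \<Longrightarrow> m \<in> S \<Longrightarrow> m' \<in> S \<Longrightarrow> 0 \<le> i \<Longrightarrow> i < p + q - 2 \<Longrightarrow> z (m + i) = z (m' + i)"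
  unfolding level_def by blast

lemma level_next:
  assumes "level z a b p q S" "m \<in> S" "z (m + (p + q - 2)) = a"
  shows "m + p \<in> S" "z (m + p - 1) = a"
  using assms unfolding level_def by blast+

lemma level_prev:
  assumes "level z a b p q S" "m \<in> S" "z (m - 1) = a"
  shows "m - p \<in> S" "z (m - p + (p + q - 2)) = a"
  using assms unfolding level_def by blast+

lemma level_init:
  assumes "a \<noteq> b" "range z \<subseteq> {a, b}"
  shows "level z a b 1 1 UNIV"
  using assms unfolding level_def by auto

lemma level_step:
  assumes L: "level z a b p q S"
    and no_bb: "\<And>m. m \<in> S \<Longrightarrow> z (m + (p + q - 2)) = b \<Longrightarrow> z (m + q + (p + q - 2)) \<noteq> b"
  shows "level z a b p (p + q) {m \<in> S. z (m + (p + q - 2)) = a}"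
proof -
  define T where "T = {m \<in> S. z (m + (p + q - 2)) = a}"
  have pos: "0 < p" "0 < q" and ab: "a \<noteq> b" and rng: "range z \<subseteq> {a, b}"
    using level_pos [OF L] level_alphabet [OF L] by auto
  note L' = level_swap [OF L]
  define N where "N = p + q - 2"
  have N': "p + (p + q) - 2 = N + p" "p + q - 2 = N" "q + p - 2 = N" by (auto simp: N_def)
  have S: "m \<in> S" "z (m + N) = a" if "m \<in> T" for m using that by (auto simp: N_def T_def)
  have inS: "m \<in> T" if "m \<in> S" "z (m + N) = a" for m using that by (auto simp: N_def T_def)
  note nxa = level_next [OF L, unfolded N'] and nxb = level_next [OF L', unfolded N']
  note pva = level_prev [OF L, unfolded N'] and pvb = level_prev [OF L', unfolded N']
  note no_bb' = no_bb [unfolded N']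
  have nb: "z i \<noteq> b \<longleftrightarrow> z i = a" for i using level_alphabet [OF L, of i] ab by auto
  have agree: "z (m + i) = z (m' + i)"
    if m: "m \<in> T" "m' \<in> T" and i: "0 \<le> i" "i < N + p" for m m' i
  proof -
    consider "i < N" | "i = N" | "i > N" by linarith
    then show ?thesis
    proof cases
      case 1
      then show ?thesis using level_agree [OF L, of m m' i] S(1) [OF m(1)] S(1) [OF m(2)] i by (simp add: N_def)
    next
      case 2
      then show ?thesis using S(2) [OF m(1)] S(2) [OF m(2)] by simp
    next
      \<comment> \<open>Beyond position \<open>N\<close> the agreement is inherited from the next
        occurrence, which lies \<open>p\<close> further on in both places.\<close>
      case 3
      then have "0 \<le> i - p" "i - p < N" using pos i by (auto simp: N_def)
      then have "z (m + p + (i - p)) = z (m' + p + (i - p))"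
        using level_agree [OF L, of "m + p" "m' + p" "i - p"] nxa(1) [OF S [OF m(1)]]
          nxa(1) [OF S [OF m(2)]] by (simp add: N_def)
      then show ?thesis by simp
    qed
  qed
  have next_a: "m + p \<in> T \<and> z (m + p - 1) = a" if "m \<in> T" "z (m + (N + p)) = a" for m
    using nxa [of m] S [OF that(1)] that(2) by (auto intro!: inS simp: algebra_simps)
  have next_b: "m + (p + q) \<in> T \<and> z (m + (p + q) - 1) = b"
    if m: "m \<in> T" "z (m + (N + p)) = b" for m
  proof -
    have 1: "m + p \<in> S" using nxa S m by blast
    have 2: "z (m + p + N) = b" using m(2) by (simp add: algebra_simps)
    have 3: "m + p + q \<in> S" "z (m + p + q - 1) = b" using nxb [OF 1 2] by auto
    have "z (m + p + q + N) = a" using no_bb' [OF 1 2] nb by blast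
    then have "m + p + q \<in> T" using inS 3 by blast
    then show ?thesis using 3 by (simp add: add.assoc)
  qed
  have prev_a: "m - p \<in> T \<and> z (m - p + (N + p)) = a" if "m \<in> T" "z (m - 1) = a" for m
    using pva [of m] S [OF that(1)] that(2) by (auto intro!: inS simp: algebra_simps)
  have prev_b: "m - (p + q) \<in> T \<and> z (m - (p + q) + (N + p)) = b"
    if m: "m \<in> T" "z (m - 1) = b" for m
  proof -
    have 1: "m - q \<in> S" "z (m - q + N) = b" using pvb [of m] S m by auto
    have 2: "z (m - q - 1) = a"
    proof (rule ccontr)
      assume "z (m - q - 1) \<noteq> a"
      then have "z (m - q - 1) = b" using nb by blast
      then have "m - q - q \<in> S" "z (m - q - q + N) = b" using pvb [OF 1(1)] by auto
      then show False using no_bb' [of "m - q - q"] 1(2) by auto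
    qed
    have "m - q - p \<in> S" "z (m - q - p + N) = a" using pva [OF 1(1) 2] by auto
    then have "m - q - p \<in> T" using inS by blast
    then show ?thesis using 1(2) by (simp add: algebra_simps)
  qed
  show ?thesis
    unfolding T_def [symmetric] unfolding level_def N'(1)
  proof (intro conjI ballI allI impI)
    show "a \<noteq> b" "range z \<subseteq> {a, b}" "0 < p" "0 < p + q" using ab rng pos by auto
  qed (use agree next_a next_b prev_a prev_b in \<open>blast+\<close>)
qed

section \<open>Which gaps can repeat in an aperiodic word\<close>

definition aperiodic :: "(int \<Rightarrow> 'a) \<Rightarrow> bool" where
  "aperiodic z \<longleftrightarrow> (\<forall>M p. 0 < p \<longrightarrow> (\<exists>i\<ge>M. z (i + p) \<noteq> z i))"

definition unique_right_special :: "(int \<Rightarrow> 'a) \<Rightarrow> bool" where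
  "unique_right_special z \<longleftrightarrow> (\<forall>n i i' j j'. 0 < n \<longrightarrow>
     (\<forall>k. 0 \<le> k \<and> k < n \<longrightarrow> z (i + k) = z (i' + k)) \<longrightarrow> z (i + n) \<noteq> z (i' + n) \<longrightarrow>
     (\<forall>k. 0 \<le> k \<and> k < n \<longrightarrow> z (j + k) = z (j' + k)) \<longrightarrow> z (j + n) \<noteq> z (j' + n) \<longrightarrow>
     (\<forall>k. 0 \<le> k \<and> k < n \<longrightarrow> z (i + k) = z (j + k)))"

text \<open>Otherwise gaps \<open>p\<close> would follow each other forever, and \<open>z\<close>
  would have period \<open>p\<close> from \<open>m\<close> on.\<close>

lemma level_changes:
  assumes L: "level z a b p q S" and ap: "aperiodic z"
    and m: "m \<in> S" "z (m + (p + q - 2)) = a"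
  shows "\<exists>m'\<in>S. z (m' + (p + q - 2)) = a \<and> z (m' + p + (p + q - 2)) = b"
proof (rule ccontr)
  assume neg: "\<not> ?thesis"
  have pos: "0 < p" "0 < q" using level_pos [OF L] by auto
  have nxt: "z (m' + p + (p + q - 2)) = a" if "m' \<in> S" "z (m' + (p + q - 2)) = a" for m'
    using neg that level_alphabet [OF L, of "m' + p + (p + q - 2)"] by blast
  have orb: "m + int k * p \<in> S \<and> z (m + int k * p + (p + q - 2)) = a" for k
  proof (induction k)
    case 0
    then show ?case using m by simp
  next
    case (Suc k)
    then show ?case using nxt [of "m + int k * p"] level_next(1) [OF L, of "m + int k * p"]
      by (simp add: algebra_simps)
  qed
  have "z (i + p) = z i" if "i \<ge> m" for i
  proof -
    define k where "k = nat ((i - m) div p)"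
    define r where "r = (i - m) mod p"
    have k: "int k = (i - m) div p" using that pos by (simp add: k_def pos_imp_zdiv_nonneg_iff)
    have i: "i = m + int k * p + r" unfolding k r_def by simp
    have ip: "i + p = m + int (Suc k) * p + r" unfolding i by (simp add: algebra_simps)
    have r: "0 \<le> r" "r < p" using pos by (auto simp: r_def)
    show ?thesis
    proof (cases "r < p + q - 2")
      case True
      then show ?thesis unfolding ip unfolding i
        using level_agree [OF L] orb r by blast
    next
      case False
      \<comment> \<open>The common word misses a remainder \<open>r < p\<close> only if
        \<open>q = 1\<close> and \<open>r = p - 1\<close>; there the letter is the \<open>a\<close>
        that announces the gap \<open>p\<close>.\<close>
      then have "r = p + q - 2" using r pos by simp
      then show ?thesis unfolding ip unfolding i using orb by metis
    qed
  qed
  then show False using ap pos unfolding aperiodic_def by blast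
qed

text \<open>Let \<open>w\<close> be the common word of length \<open>p + q - 2\<close>. If both gaps
  could occur twice in a row, both \<open>a w\<close> and \<open>b w\<close> would be right special,
  although they have the same length and differ in their first letter.\<close>

lemma level_not_both:
  assumes L: "level z a b p q S" and ap: "aperiodic z" and urs: "unique_right_special z"
    and m: "m \<in> S" "z (m + (p + q - 2)) = a" "z (m + p + (p + q - 2)) = a"
    and n: "n \<in> S" "z (n + (p + q - 2)) = b" "z (n + q + (p + q - 2)) = b"
  shows False
proof -
  define N where "N = p + q - 2"
  have N': "p + q - 2 = N" "q + p - 2 = N" by (auto simp: N_def)
  have pos: "0 < p" "0 < q" "a \<noteq> b" using level_pos [OF L] by auto
  note L' = level_swap [OF L]
  note m = m [unfolded N'] and n = n [unfolded N']
  obtain m' where m': "m' \<in> S" "z (m' + N) = a" "z (m' + p + N) = b"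
    using level_changes [OF L ap, unfolded N'] m by blast
  obtain n' where n': "n' \<in> S" "z (n' + N) = b" "z (n' + q + N) = a"
    using level_changes [OF L' ap, unfolded N'] n by blast
  note nxa = level_next [OF L, unfolded N'] and nxb = level_next [OF L', unfolded N']
  have eqa: "z (m + p - 1 + k) = z (m' + p - 1 + k)" if "0 \<le> k" "k < N + 1" for k
  proof (cases "k = 0")
    case True
    then show ?thesis using nxa m m' by simp
  next
    case False
    then have "z (m + p + (k - 1)) = z (m' + p + (k - 1))"
      using level_agree [OF L, of "m + p" "m' + p" "k - 1"] nxa m m' that N_def by auto
    then show ?thesis by (simp add: algebra_simps)
  qed
  have eqb: "z (n + q - 1 + k) = z (n' + q - 1 + k)" if "0 \<le> k" "k < N + 1" for k
  proof (cases "k = 0")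
    case True
    then show ?thesis using nxb n n' by simp
  next
    case False
    then have "z (n + q + (k - 1)) = z (n' + q + (k - 1))"
      using level_agree [OF L, of "n + q" "n' + q" "k - 1"] nxb n n' that N_def by auto
    then show ?thesis by (simp add: algebra_simps)
  qed
  have N0: "0 < N + 1" using pos by (simp add: N_def)
  have da: "z (m + p - 1 + (N + 1)) \<noteq> z (m' + p - 1 + (N + 1))"
    and db: "z (n + q - 1 + (N + 1)) \<noteq> z (n' + q - 1 + (N + 1))"
    using m m' n n' pos by (simp_all add: algebra_simps)
  have "z (m + p - 1 + 0) = z (n + q - 1 + 0)"
    using urs [unfolded unique_right_special_def, rule_format, of "N + 1" "m + p - 1" "m' + p - 1"
        "n + q - 1" "n' + q - 1" 0] eqa eqb N0 da db by blast
  then show False using nxa(2) [of m] nxb(2) [of n] m n pos by simp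
qed

text \<open>
  Here \<open>e\<close> is the first element of \<open>S\<close> that is not negative. \<open>X\<close> and \<open>Y\<close> say whether the gap
  that ends in \<open>e\<close>, respectively starts in \<open>e\<close>, is the one of length \<open>q\<close>.
\<close>

definition state_at ::
  "(int \<Rightarrow> 'a) \<Rightarrow> 'a \<Rightarrow> 'a \<Rightarrow> int \<Rightarrow> int \<Rightarrow> int set \<Rightarrow> int \<Rightarrow> bool \<Rightarrow> bool \<Rightarrow> bool" where
  "state_at z a b p q S e X Y \<longleftrightarrow> level z a b p q S \<and> e \<in> S \<and> 0 \<le> e \<and>
     (X \<longleftrightarrow> z (e - 1) = b) \<and> (Y \<longleftrightarrow> z (e + (p + q - 2)) = b) \<and> e < (if X then q else p)"

definition state :: "(int \<Rightarrow> 'a) \<Rightarrow> int \<Rightarrow> int \<Rightarrow> int \<Rightarrow> bool \<Rightarrow> bool \<Rightarrow> bool" where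
  "state z p q e X Y \<longleftrightarrow> p \<le> q \<and> (\<exists>a b S. state_at z a b p q S e X Y)"

lemma state_at_swap:
  assumes "state_at z a b p q S e X Y"
  shows "state_at z b a q p S e (\<not> X) (\<not> Y)"
proof -
  have L: "level z a b p q S"
    using assms unfolding state_at_def by auto
  have "z i = a \<longleftrightarrow> z i \<noteq> b" for i using level_alphabet [OF L, of i] level_pos [OF L] by auto
  then show ?thesis
    using assms level_swap [OF L] unfolding state_at_def by (auto simp: add.commute [of q p] split: if_splits)
qed

text \<open>Only occurrences with a gap \<open>q\<close> ahead disappear. If \<open>e\<close> is one
  of them, the gap before it is \<open>p\<close>, so \<open>e < p\<close>, and \<open>e + q\<close>
  becomes the first non-negative occurrence, at the end of a merged gap
  \<open>p + q\<close>.\<close>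

lemma state_at_step:
  assumes st: "state_at z a b p q S e X Y"
    and no_bb: "\<And>m. m \<in> S \<Longrightarrow> z (m + (p + q - 2)) = b \<Longrightarrow> z (m + q + (p + q - 2)) \<noteq> b"
  defines "T \<equiv> {m \<in> S. z (m + (p + q - 2)) = a}"
  shows "\<not> (X \<and> Y)"
    and "\<not> Y \<Longrightarrow> \<exists>Y'. state_at z a b p (p + q) T e X Y'"
    and "Y \<Longrightarrow> \<exists>Y'. state_at z a b p (p + q) T (e + q) True Y'"
proof -
  have L: "level z a b p q S" and e: "e \<in> S" "0 \<le> e" "X \<longleftrightarrow> z (e - 1) = b"
      "Y \<longleftrightarrow> z (e + (p + q - 2)) = b" "e < (if X then q else p)"
    using st unfolding state_at_def by auto
  have pos: "0 < p" "0 < q" and ab: "a \<noteq> b" using level_pos [OF L] by auto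
  have nb: "z i = a \<longleftrightarrow> z i \<noteq> b" for i using level_alphabet [OF L, of i] ab by auto
  have L': "level z a b p (p + q) T" unfolding T_def by (rule level_step [OF L no_bb])
  show 1: "\<not> (X \<and> Y)"
  proof
    assume "X \<and> Y"
    then have "e - q \<in> S" "z (e - q + (q + p - 2)) = b" "z (e + (p + q - 2)) = b"
      using level_prev [OF level_swap [OF L], of e] e by auto
    then show False using no_bb [of "e - q"] by (simp add: add.commute [of q p])
  qed
  show "\<exists>Y'. state_at z a b p (p + q) T e X Y'" if "\<not> Y"
  proof -
    have "e \<in> T" using that e nb by (simp add: T_def)
    moreover have "e < (if X then p + q else p)" using e pos by (auto split: if_splits)
    ultimately show ?thesis using L' e(2,3) unfolding state_at_def by blast
  qed
  show "\<exists>Y'. state_at z a b p (p + q) T (e + q) True Y'" if Y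
  proof -
    have zb: "z (e + (p + q - 2)) = b" using that e by simp
    then have *: "e + q \<in> S" "z (e + q - 1) = b"
      using level_next [OF level_swap [OF L], of e] e(1) by (auto simp: add.commute [of q p])
    moreover have "z (e + q + (p + q - 2)) = a" using no_bb [OF e(1) zb] nb by blast
    ultimately have "e + q \<in> T" by (simp add: T_def)
    moreover have "e < p" using 1 that e by auto
    ultimately show ?thesis using L' * e(2) pos unfolding state_at_def by auto
  qed
qed

text \<open>The case tells which gap never occurs twice in a row and is merged away:
  \<open>q\<close> in \<open>keep_short\<close>, \<open>p\<close> in \<open>keep_long\<close>. The
  second case is the first with the letters exchanged.\<close>

lemma state_step:
  assumes ap: "aperiodic z" and urs: "unique_right_special z" and st: "state z p q e X Y"
  obtains
    (keep_short) "\<not> (X \<and> Y)" "\<not> Y \<Longrightarrow> \<exists>Y'. state z p (p + q) e X Y'"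
      "Y \<Longrightarrow> \<exists>Y'. state z p (p + q) (e + q) True Y'"
  | (keep_long) "X \<or> Y" "Y \<Longrightarrow> \<exists>Y'. state z q (p + q) e (\<not> X) Y'"
      "\<not> Y \<Longrightarrow> \<exists>Y'. state z q (p + q) (e + p) True Y'"
proof -
  obtain a b S where st': "state_at z a b p q S e X Y" and pq: "p \<le> q"
    using st unfolding state_def by auto
  have L: "level z a b p q S" using st' unfolding state_at_def by auto
  have pos: "0 < p" "0 < q" using level_pos [OF L] by auto
  consider "\<And>m. m \<in> S \<Longrightarrow> z (m + (p + q - 2)) = b \<Longrightarrow> z (m + q + (p + q - 2)) \<noteq> b"
    | "\<And>m. m \<in> S \<Longrightarrow> z (m + (q + p - 2)) = a \<Longrightarrow> z (m + p + (q + p - 2)) \<noteq> a"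
    using level_not_both [OF L ap urs] unfolding add.commute [of q p] by metis
  then show thesis
  proof cases
    case 1
    note * = state_at_step [OF st' 1]
    show thesis
    proof (rule keep_short)
      show "\<not> (X \<and> Y)" using *(1) by blast
      show "\<exists>Y'. state z p (p + q) e X Y'" if "\<not> Y"
        using *(2) that pos unfolding state_def by fastforce
      show "\<exists>Y'. state z p (p + q) (e + q) True Y'" if Y
        using *(3) that pos unfolding state_def by fastforce
    qed
  next
    case 2
    note * = state_at_step [OF state_at_swap [OF st'] 2, unfolded add.commute [of q p]]
    show thesis
    proof (rule keep_long)
      show "X \<or> Y" using *(1) by blast
      show "\<exists>Y'. state z q (p + q) e (\<not> X) Y'" if Y
        using *(2) that pos unfolding state_def by fastforce
      show "\<exists>Y'. state z q (p + q) (e + p) True Y'" if "\<not> Y"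
        using *(3) that pos unfolding state_def by fastforce
    qed
  qed
qed

section \<open>Repetitions read off from a state\<close>

definition late_repetitions :: "(int \<Rightarrow> 'a) \<Rightarrow> real \<Rightarrow> int \<Rightarrow> bool" where
  "late_repetitions z \<gamma> n0 \<longleftrightarrow> (\<forall>j d n. 0 \<le> j \<longrightarrow> 0 < d \<longrightarrow> n0 \<le> n \<longrightarrow>
     (\<forall>k. 0 \<le> k \<and> k < n \<longrightarrow> z (j + k) = z (j + d + k)) \<longrightarrow> \<gamma> * n \<le> j + d)"

text \<open>The common word at \<open>e\<close> and \<open>e + p\<close> gives the first bound. For
  the second, the occurrence at \<open>e - p < 0\<close> is cut off at 0, which leaves length
  \<open>q + e - 2\<close> at distance \<open>p\<close>. If both gaps are \<open>p\<close>, the two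
  stretches of period \<open>p\<close> join into one.\<close>

lemma state_at_repetitions:
  assumes late: "late_repetitions z \<gamma> n0" and st: "state_at z a b p q S e X Y"
  shows "\<not> Y \<Longrightarrow> n0 \<le> p + q - 2 \<Longrightarrow> \<gamma> * (p + q - 2) \<le> e + p"
    and "\<not> X \<Longrightarrow> n0 \<le> q + e - 2 \<Longrightarrow> \<gamma> * (q + e - 2) \<le> p"
    and "\<not> X \<Longrightarrow> \<not> Y \<Longrightarrow> n0 \<le> p + q - 2 \<Longrightarrow> \<gamma> * (p + q - 2) \<le> p"
proof -
  have L: "level z a b p q S" and e: "e \<in> S" "0 \<le> e" "X \<longleftrightarrow> z (e - 1) = b"
      "Y \<longleftrightarrow> z (e + (p + q - 2)) = b" "e < (if X then q else p)"
    using st unfolding state_at_def by auto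
  have pos: "0 < p" "0 < q" using level_pos [OF L] by auto
  have nxt: "e + p \<in> S" "z (e + (p + q - 2)) = a" if "\<not> Y"
  proof -
    show *: "z (e + (p + q - 2)) = a" using e that level_alphabet [OF L] by blast
    show "e + p \<in> S" using level_next [OF L e(1) *] by blast
  qed
  have prv: "e - p \<in> S" "z (e - p + (p + q - 2)) = a" "e < p" if "\<not> X"
  proof -
    have *: "z (e - 1) = a" using e that level_alphabet [OF L] by blast
    show "e - p \<in> S" "z (e - p + (p + q - 2)) = a" using level_prev [OF L e(1) *] by blast+
    show "e < p" using e that by simp
  qed
  have late': "\<gamma> * n \<le> j + d" if "0 \<le> j" "0 < d" "n0 \<le> n"
      "\<And>k. 0 \<le> k \<Longrightarrow> k < n \<Longrightarrow> z (j + k) = z (j + d + k)" for j d n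
    using late that unfolding late_repetitions_def by blast
  show "\<gamma> * (p + q - 2) \<le> e + p" if "\<not> Y" "n0 \<le> p + q - 2"
    using late' [of e p "p + q - 2"] level_agree [OF L e(1) nxt(1)] that e pos by auto
  have before: "z (0 + k) = z (0 + p + k)" if "\<not> X" "0 \<le> k" "k < q + e - 2" for k
    using level_agree [OF L prv(1) e(1), of "k + p - e"] prv(3) that by (simp add: algebra_simps)
  show "\<gamma> * (q + e - 2) \<le> p" if "\<not> X" "n0 \<le> q + e - 2"
    using late' [of 0 p "q + e - 2"] before that pos by simp
  show "\<gamma> * (p + q - 2) \<le> p" if XY: "\<not> X" "\<not> Y" and n0: "n0 \<le> p + q - 2"
  proof -
    have "z (0 + k) = z (0 + p + k)" if k: "0 \<le> k" "k < p + q - 2" for k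
    proof -
      consider "k < q + e - 2" | "k = q + e - 2" | "k > q + e - 2" by linarith
      then show ?thesis
      proof cases
        case 1
        then show ?thesis using before XY k by blast
      next
        \<comment> \<open>Both occurrences are followed by \<open>a\<close>. For
          \<open>q = 1\<close> this position is the only link between the two stretches.\<close>
        case 2
        show ?thesis
          unfolding 2 using prv(2) [OF XY(1)] nxt(2) [OF XY(2)] by (simp add: algebra_simps)
      next
        case 3
        then show ?thesis
          using level_agree [OF L e(1) nxt(1) [OF XY(2)], of "k - e"] e(2) k pos
          by (simp add: algebra_simps)
      qed
    qed
    then show ?thesis using late' [of 0 p "p + q - 2"] n0 pos by simp
  qed
qed

lemma state_repetitions:
  assumes late: "late_repetitions z \<gamma> n0" and st: "state z p q e X Y"
  shows "n0 \<le> p + q - 2 \<Longrightarrow> \<gamma> * (p + q - 2) \<le> e + (if Y then q else p)"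
    and "n0 \<le> (if X then p else q) + e - 2 \<Longrightarrow>
           \<gamma> * ((if X then p else q) + e - 2) \<le> (if X then q else p)"
    and "X = Y \<Longrightarrow> n0 \<le> p + q - 2 \<Longrightarrow> \<gamma> * (p + q - 2) \<le> (if X then q else p)"
proof -
  obtain a b S where st': "state_at z a b p q S e X Y"
    using st unfolding state_def by auto
  note 1 = state_at_repetitions [OF late st']
  note 2 = state_at_repetitions [OF late state_at_swap [OF st'], unfolded add.commute [of q p]]
  show "n0 \<le> p + q - 2 \<Longrightarrow> \<gamma> * (p + q - 2) \<le> e + (if Y then q else p)"
    using 1(1) 2(1) by auto
  show "n0 \<le> (if X then p else q) + e - 2 \<Longrightarrow>
      \<gamma> * ((if X then p else q) + e - 2) \<le> (if X then q else p)"
    using 1(2) 2(2) by auto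
  show "X = Y \<Longrightarrow> n0 \<le> p + q - 2 \<Longrightarrow> \<gamma> * (p + q - 2) \<le> (if X then q else p)"
    using 1(3) 2(3) by auto
qed

lemma state_pos: "state z p q e X Y \<Longrightarrow> 0 < p \<and> p \<le> q \<and> 0 \<le> e \<and> e < (if X then q else p)"
  unfolding state_def state_at_def using level_pos by fastforce

lemma state_init:
  assumes "a \<noteq> b" "range z \<subseteq> {a, b}"
  shows "\<exists>X Y. state z 1 1 0 X Y"
proof -
  have "state_at z a b 1 1 UNIV 0 (z (- 1) = b) (z 0 = b)"
    using level_init [OF assms] unfolding state_at_def by simp
  then show ?thesis unfolding state_def by blast
qed

section \<open>Linear inequalities between gaps\<close>

text \<open>
  The constant \<open>66 / 100\<close> is just some rational slightly below \<open>sqrt 10 - 5 / 2\<close>; the margin absorbs the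
  additive constants. In the names \<open>forbidden_\<dots>\<close> and \<open>step_\<dots>\<close>, the digit 1 stands for a step
  \<open>(p, q, e) \<rightarrow> (p, p + q, e)\<close> and 2 for a step \<open>(p, q, e) \<rightarrow> (q, p + q, e + p)\<close>.
\<close>

definition admissible :: "real \<Rightarrow> real \<Rightarrow> real \<Rightarrow> bool" where
  "admissible p q e \<longleftrightarrow>
     0 < p \<and> p \<le> q \<and> 0 \<le> e \<and> 66 / 100 * (p + q) \<le> e + p \<and> 66 / 100 * (p + e) \<le> q"

text \<open>The first bound at the last state gives \<open>0.64 p + 0.98 q <= e\<close>, the second
  bound one state earlier gives \<open>0.66 e <= 0.68 p + 0.34 q\<close>; this is impossible for
  \<open>p <= q\<close>.\<close>

lemma forbidden_121:
  assumes "admissible p q e" "admissible p (p + q) e"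
    "admissible (p + q) (2 * p + q) (e + p)" "admissible (p + q) (3 * p + 2 * q) (e + p)"
  shows False
  using assms unfolding admissible_def by argo

lemma forbidden_211:
  assumes "admissible p q e" "admissible q (p + q) (e + p)"
    "admissible q (p + 2 * q) (e + p)" "admissible q (p + 3 * q) (e + p)"
  shows False
  using assms unfolding admissible_def by argo

text \<open>The first bound at the first state gives \<open>0.66 q - 0.34 p <= e\<close>, the second
  bound at the last state \<open>0.66 e <= 0.38 q - 0.3 p\<close>.\<close>

lemma forbidden_2222:
  assumes "admissible p q e" "admissible q (p + q) (e + p)"
    "admissible (p + q) (p + 2 * q) (e + p + q)"
    "admissible (p + 2 * q) (2 * p + 3 * q) (e + 2 * p + 2 * q)"
    "admissible (2 * p + 3 * q) (3 * p + 5 * q) (e + 3 * p + 4 * q)"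
  shows False
  using assms unfolding admissible_def by argo

lemma forbidden_21221:
  assumes "admissible p q e" "admissible q (p + q) (e + p)"
    "admissible q (p + 2 * q) (e + p)" "admissible (p + 2 * q) (p + 3 * q) (e + p + q)"
    "admissible (p + 3 * q) (2 * p + 5 * q) (e + 2 * p + 3 * q)"
    "admissible (p + 3 * q) (3 * p + 8 * q) (e + 2 * p + 3 * q)"
  shows False
  using assms unfolding admissible_def by argo

section \<open>Reduction to states with a long gap before \<open>e\<close> and a short gap after
  it\<close>

locale late_word =
  fixes z :: "int \<Rightarrow> 'a" and \<gamma> :: real and n0 :: int
  assumes aperiodic: "aperiodic z" and urs: "unique_right_special z"
    and late: "late_repetitions z \<gamma> n0" and gamma: "sqrt 10 - 5 / 2 < \<gamma>"
begin

definition K :: int where "K = max 1000 (n0 + 2)"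

lemma K: "1000 \<le> K" "n0 \<le> K - 2"
  by (auto simp: K_def)

lemma gamma_lower: "6622 / 10000 \<le> \<gamma>"
proof -
  have "31622 / 10000 \<le> sqrt 10" by (rule real_le_rsqrt) (simp add: power2_eq_square)
  then show ?thesis using gamma by simp
qed

text \<open>The slack \<open>0.0022 m\<close> between 0.6622 and 0.66 exceeds
  \<open>2 * 0.6622\<close> well before \<open>m = 1000\<close>.\<close>

lemma absorb_constant:
  assumes "\<gamma> * (m - 2) \<le> x" "1000 \<le> m"
  shows "66 / 100 * m \<le> x"
proof -
  have "6622 / 10000 * (m - 2) \<le> \<gamma> * (m - 2)"
    using gamma_lower assms(2) by (intro mult_right_mono) auto
  then show ?thesis using assms by simp
qed

lemma first_bound:
  assumes "state z p q e X Y" "K \<le> q"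
  shows "66 / 100 * (real_of_int p + q) \<le> real_of_int e + (if Y then q else p)"
  using state_repetitions(1) [OF late assms(1)] state_pos [OF assms(1)] assms(2) K
  by (intro absorb_constant) auto

lemma second_bound:
  assumes "state z p q e X Y" "K \<le> p"
  shows "66 / 100 * (real_of_int (if X then p else q) + e) \<le> (if X then q else p)"
  using state_repetitions(2) [OF late assms(1)] state_pos [OF assms(1)] assms(2) K
  by (intro absorb_constant) auto

lemma third_bound:
  assumes "state z p q e X X" "K \<le> q"
  shows "66 / 100 * (real_of_int p + q) \<le> (if X then q else p)"
  using state_repetitions(3) [OF late assms(1)] state_pos [OF assms(1)] assms(2) K
  by (intro absorb_constant) auto

lemma no_short_short:
  assumes "state z p q e False False" "K \<le> q"
  shows False
  using third_bound [OF assms] state_pos [OF assms(1)] by auto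

text \<open>Two long gaps force a \<open>keep_long\<close> step, after which the gap ending in
  \<open>e\<close> is short. The second bound there reads \<open>0.66 (p + q + e) <= q\<close>,
  which \<open>big\<close> contradicts since 0.66 * 1.66 > 1.\<close>

lemma no_long_long:
  assumes st: "state z p q e True True" and K_le: "K \<le> p"
    and big: "66 / 100 * real_of_int q \<le> real_of_int p + e"
  shows False
  using aperiodic urs st
proof (cases rule: state_step)
  case keep_short
  then show ?thesis by simp
next
  case keep_long
  have pos: "0 < p" "p \<le> q" using state_pos [OF st] by auto
  obtain Y' where Y': "state z q (p + q) e False Y'" using keep_long by auto
  show ?thesis
  proof (cases Y')
    case True
    then show ?thesis using second_bound [of q "p + q" e False Y'] Y' K_le pos big by auto
  next
    case False
    then show ?thesis using no_short_short [of q "p + q" e] Y' K_le pos by auto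
  qed
qed

definition run :: "int \<Rightarrow> int \<Rightarrow> int \<Rightarrow> bool" where
  "run p q e \<longleftrightarrow> state z p q e True False \<and> K \<le> p"

lemma run_admissible: "run p q e \<Longrightarrow> admissible p q e"
  unfolding run_def admissible_def
  using first_bound [of p q e True False] second_bound [of p q e True False]
    state_pos [of z p q e True False] by auto

text \<open>The gap ending in the new \<open>e\<close> is long in either case, so only a long gap
  ahead could end the run. The premise \<open>big\<close> of \<open>no_long_long\<close> is the
  first bound for step 1 and trivial for step 2.\<close>

lemma run_step:
  assumes "run p q e"
  shows "run p (p + q) e \<or> run q (p + q) (e + p)"
proof -
  have st: "state z p q e True False" and K_le: "K \<le> p" using assms unfolding run_def by auto
  have pos: "0 < p" "p \<le> q" "0 \<le> e" using state_pos [OF st] by auto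
  have b: "66 / 100 * (real_of_int p + q) \<le> real_of_int e + p"
    using first_bound [OF st] K_le pos by auto
  from aperiodic urs st show ?thesis
  proof (cases rule: state_step)
    case keep_short
    then obtain Y' where Y': "state z p (p + q) e True Y'" by auto
    then have "\<not> Y'" using no_long_long [of p "p + q" e] K_le b by auto
    then show ?thesis using Y' K_le unfolding run_def by auto
  next
    case keep_long
    then obtain Y' where Y': "state z q (p + q) (e + p) True Y'" by auto
    then have "\<not> Y'" using no_long_long [of q "p + q" "e + p"] K_le pos by auto
    then show ?thesis using Y' K_le pos unfolding run_def by auto
  qed
qed

lemma run_from_short_long:
  assumes st: "state z p q e False True" and K_le: "K \<le> p"
  shows "\<exists>p q e. run p q e"
proof -
  have pos: "0 < p" "p \<le> q" "0 \<le> e" using state_pos [OF st] by auto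
  have b: "66 / 100 * (real_of_int p + q) \<le> real_of_int e + q"
    using first_bound [OF st] K_le pos by auto
  from aperiodic urs st show ?thesis
  proof (cases rule: state_step)
    case keep_short
    then obtain Y' where Y': "state z p (p + q) (e + q) True Y'" by auto
    then have "\<not> Y'" using no_long_long [of p "p + q" "e + q"] K_le b pos by auto
    then show ?thesis using Y' K_le unfolding run_def by auto
  next
    case keep_long
    then obtain Y' where Y': "state z q (p + q) e True Y'" by auto
    then have "\<not> Y'" using no_long_long [of q "p + q" e] K_le b pos by auto
    then show ?thesis using Y' K_le pos order_trans [OF K_le] unfolding run_def by auto
  qed
qed

lemma run_from_state:
  assumes st: "state z p q e X Y" and K_le: "K \<le> p"
  shows "\<exists>p q e. run p q e"
proof -
  have pos: "0 < p" "p \<le> q" "0 \<le> e" using state_pos [OF st] by auto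
  consider "\<not> X" "\<not> Y" | "X" "\<not> Y" | "\<not> X" "Y" | "X" "Y" by blast
  then show ?thesis
  proof cases
    case 1
    then show ?thesis using no_short_short [of p q e] st K_le pos by auto
  next
    case 2
    then show ?thesis using st K_le unfolding run_def by auto
  next
    case 3
    then show ?thesis using run_from_short_long [of p q e] st K_le by auto
  next
    case 4
    with st have st': "state z p q e True True" by simp
    from aperiodic urs st' show ?thesis
    proof (cases rule: state_step)
      case keep_short
      then show ?thesis by simp
    next
      case keep_long
      then obtain Y' where Y': "state z q (p + q) e False Y'" by auto
      then have "Y'" using no_short_short [of q "p + q" e] K_le pos by (cases Y') auto
      then show ?thesis using run_from_short_long [of q "p + q" e] Y' K_le pos by auto
    qed
  qed
qed

text \<open>A \<open>keep_short\<close> step fixes \<open>p\<close> and \<open>e\<close> and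
  enlarges \<open>q\<close>, but the first bound keeps \<open>q < 2 * (e + p)\<close>. So a
  \<open>keep_long\<close> step must come, and it makes \<open>q\<close> the new short gap.\<close>

lemma large_state_from_long:
  assumes "state z p q e True Y" "K \<le> q"
  shows "\<exists>p q e X Y. state z p q e X Y \<and> K \<le> p"
  using assms
proof (induction "nat (2 * (e + p) - q)" arbitrary: q Y rule: less_induct)
  case less
  note st = less.prems(1)
  have pos: "0 < p" "p \<le> q" "0 \<le> e" using state_pos [OF st] by auto
  from aperiodic urs st show ?case
  proof (cases rule: state_step)
    case keep_long
    then obtain e' X' Y' where "state z q (p + q) e' X' Y'" by metis
    then show ?thesis using less.prems by blast
  next
    case keep_short
    then have "\<not> Y" by simp
    then obtain Y' where Y': "state z p (p + q) e True Y'" using keep_short by auto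
    have "66 / 100 * (real_of_int p + q) \<le> real_of_int e + p"
      using first_bound [OF st] less.prems \<open>\<not> Y\<close> by auto
    then have "real_of_int q < real_of_int (2 * (e + p))" using pos by simp
    then have "q < 2 * (e + p)" by linarith
    then show ?thesis using less.hyps [OF _ Y'] less.prems pos by auto
  qed
qed

lemma state_long_unbounded:
  assumes "state z p q e X Y"
  shows "\<exists>p q e X Y. state z p q e X Y \<and> m \<le> q"
  using assms
proof (induction "nat (m - q)" arbitrary: p q e X Y rule: less_induct)
  case less
  show ?case
  proof (cases "m \<le> q")
    case True
    then show ?thesis using less.prems by blast
  next
    case False
    have pos: "0 < p" using state_pos [OF less.prems] by auto
    from aperiodic urs less.prems obtain p' e' X' Y' where "state z p' (p + q) e' X' Y'"
      by (cases rule: state_step) metis+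
    then show ?thesis using less.hyps [of "p + q"] False pos by auto
  qed
qed

lemma run_exists:
  assumes "state z p q e X Y"
  shows "\<exists>p q e. run p q e"
proof -
  obtain p q e X Y where st: "state z p q e X Y" and K_le: "K \<le> q"
    using state_long_unbounded [OF assms] by blast
  have pos: "0 < p" "p \<le> q" "0 \<le> e" using state_pos [OF st] by auto
  have "\<exists>p q e X Y. state z p q e X Y \<and> K \<le> p"
  proof (cases X)
    case True
    then show ?thesis using large_state_from_long st K_le by auto
  next
    case False
    then have Y using no_short_short [of p q e] st K_le by (cases Y) auto
    with False st have st': "state z p q e False True" by simp
    from aperiodic urs st' obtain p' e' Y' where "state z p' (p + q) e' True Y'"
      by (cases rule: state_step) auto
    then show ?thesis using large_state_from_long K_le pos by auto
  qed
  then show ?thesis using run_from_state by blast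
qed

text \<open>Steps of type 1 cannot continue forever, by the same bound
  \<open>q < 2 * (e + p)\<close>.\<close>

lemma run_grows:
  assumes "run p q e"
  shows "\<exists>p q e. run p q e \<and> run q (p + q) (e + p)"
  using assms
proof (induction "nat (2 * (e + p) - q)" arbitrary: q rule: less_induct)
  case less
  have adm: "admissible p q e" using run_admissible less.prems by blast
  show ?case
  proof (cases "run q (p + q) (e + p)")
    case True
    then show ?thesis using less.prems by blast
  next
    case False
    then have "run p (p + q) e" using run_step less.prems by blast
    moreover have "real_of_int q < real_of_int (2 * (e + p))"
      using adm unfolding admissible_def by simp
    then have "q < 2 * (e + p)" by linarith
    moreover have "0 < p" using adm unfolding admissible_def by simp
    ultimately show ?thesis using less.hyps [of "p + q"] by auto
  qed
qed

text \<open>The last digit of the name is the step type that is ruled out, here and in the next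
  three lemmas; \<open>run_step\<close> leaves only the other type.\<close>

lemma step_211: "run p q e \<Longrightarrow> run q (p + q) (e + p) \<Longrightarrow> run q (p + 2 * q) (e + p) \<Longrightarrow>
    run (p + 2 * q) (p + 3 * q) (e + p + q)"
  using run_step [of q "p + 2 * q" "e + p"] forbidden_211 [of p q e]
  by (auto simp: algebra_simps dest!: run_admissible)

lemma step_121: "run p q e \<Longrightarrow> run p (p + q) e \<Longrightarrow> run (p + q) (2 * p + q) (e + p) \<Longrightarrow>
    run (2 * p + q) (3 * p + 2 * q) (e + 2 * p + q)"
  using run_step [of "p + q" "2 * p + q" "e + p"] forbidden_121 [of p q e]
  by (auto simp: algebra_simps dest!: run_admissible)

lemma step_2222: "run p q e \<Longrightarrow> run q (p + q) (e + p) \<Longrightarrow> run (p + q) (p + 2 * q) (e + p + q) \<Longrightarrow>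
    run (p + 2 * q) (2 * p + 3 * q) (e + 2 * p + 2 * q) \<Longrightarrow>
    run (p + 2 * q) (3 * p + 5 * q) (e + 2 * p + 2 * q)"
  using run_step [of "p + 2 * q" "2 * p + 3 * q" "e + 2 * p + 2 * q"] forbidden_2222 [of p q e]
  by (auto simp: algebra_simps dest!: run_admissible)

lemma step_21221: "run p q e \<Longrightarrow> run q (p + q) (e + p) \<Longrightarrow> run q (p + 2 * q) (e + p) \<Longrightarrow>
    run (p + 2 * q) (p + 3 * q) (e + p + q) \<Longrightarrow>
    run (p + 3 * q) (2 * p + 5 * q) (e + 2 * p + 3 * q) \<Longrightarrow>
    run (2 * p + 5 * q) (3 * p + 8 * q) (e + 3 * p + 6 * q)"
  using run_step [of "p + 3 * q" "2 * p + 5 * q" "e + 2 * p + 3 * q"] forbidden_21221 [of p q e]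
  by (auto simp: algebra_simps dest!: run_admissible)

section \<open>Periodicity of the step types and the contradiction\<close>

definition block :: "int \<Rightarrow> int \<Rightarrow> int \<Rightarrow> bool" where
  "block p q e \<longleftrightarrow> run p q e \<and> run q (p + q) (e + p) \<and> run (p + q) (p + 2 * q) (e + p + q) \<and>
     run (p + 2 * q) (2 * p + 3 * q) (e + 2 * p + 2 * q)"

text \<open>After steps 2, 1 the next three steps must be 2, by excluding 211, 121 and 21221 in
  turn.\<close>

lemma block_after_21:
  assumes "run p q e" "run q (p + q) (e + p)" "run q (p + 2 * q) (e + p)"
  shows "block q (p + 2 * q) (e + p)"
proof -
  have 1: "run (p + 2 * q) (p + 3 * q) (e + p + q)" using step_211 assms .
  have 2: "run (p + 3 * q) (2 * p + 5 * q) (e + 2 * p + 3 * q)"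
    using step_121 [of q "p + q" "e + p"] assms 1 by (simp add: algebra_simps)
  have 3: "run (2 * p + 5 * q) (3 * p + 8 * q) (e + 3 * p + 6 * q)"
    using step_21221 assms 1 2 .
  show ?thesis unfolding block_def using assms 1 2 3 by (simp add: algebra_simps)
qed

text \<open>After 2, 2, 2 comes 1 by \<open>step_2222\<close>; the last 2 and this 1 are the start
  required by \<open>block_after_21\<close>.\<close>

lemma block_step:
  assumes "block p q e"
  shows "block (p + 2 * q) (3 * p + 5 * q) (e + 2 * p + 2 * q)"
proof -
  have "run (p + 2 * q) (3 * p + 5 * q) (e + 2 * p + 2 * q)"
    using step_2222 assms unfolding block_def by blast
  then show ?thesis
    using block_after_21 [of "p + q" "p + 2 * q" "e + p + q"] assms
    unfolding block_def by (simp add: algebra_simps)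
qed

text \<open>After a step 2, either a 1 comes within two steps and \<open>block_after_21\<close>
  applies, or three steps 2 in a row already form a block.\<close>

lemma block_exists:
  assumes "run p q e"
  shows "\<exists>p q e. block p q e"
proof -
  obtain p q e where r: "run p q e" "run q (p + q) (e + p)" using run_grows [OF assms] by blast
  have 1: "run q (p + 2 * q) (e + p) \<or> run (p + q) (p + 2 * q) (e + p + q)"
    using run_step [OF r(2)] by (simp add: algebra_simps)
  show ?thesis
  proof (cases "run q (p + 2 * q) (e + p)")
    case True
    then show ?thesis using block_after_21 r by blast
  next
    case False
    with 1 have r3: "run (p + q) (p + 2 * q) (e + p + q)" by simp
    have 2: "run (p + q) (2 * p + 3 * q) (e + p + q) \<or>
        run (p + 2 * q) (2 * p + 3 * q) (e + 2 * p + 2 * q)"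
      using run_step [OF r3] by (simp add: algebra_simps)
    show ?thesis
    proof (cases "run (p + q) (2 * p + 3 * q) (e + p + q)")
      case True
      then have "block (p + q) (q + 2 * (p + q)) (e + p + q)"
        using block_after_21 [of q "p + q" "e + p"] r r3 by (simp add: algebra_simps)
      then show ?thesis by blast
    next
      case False
      then have "block p q e" using 2 r r3 unfolding block_def by simp
      then show ?thesis by blast
    qed
  qed
qed

text \<open>
  The step from a block to the next one is linear with eigenvalues \<open>3 + sqrt 10\<close>, \<open>3 - sqrt 10\<close>
  and 1; the two quantities controlled here are the left eigenvectors of the last two.
\<close>

lemma blocks_bounded:
  assumes "block p0 q0 e0"
  shows "\<exists>p q e. block p q e \<and> p0 + int k \<le> p \<and>
     \<bar>real_of_int p + (2 - sqrt 10) / 3 * q\<bar> \<le> \<bar>real_of_int p0 + (2 - sqrt 10) / 3 * q0\<bar> \<and>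
     3 * e + p - 2 * q = 3 * e0 + p0 - 2 * q0"
proof (induction k)
  case 0
  then show ?case using assms by auto
next
  case (Suc k)
  then obtain p q e where b: "block p q e" and p: "p0 + int k \<le> p"
    and u: "\<bar>real_of_int p + (2 - sqrt 10) / 3 * q\<bar> \<le> \<bar>real_of_int p0 + (2 - sqrt 10) / 3 * q0\<bar>"
    and v: "3 * e + p - 2 * q = 3 * e0 + p0 - 2 * q0" by blast
  define p' q' e' where "p' = p + 2 * q" and "q' = 3 * p + 5 * q" and "e' = e + 2 * p + 2 * q"
  have "real_of_int p' + (2 - sqrt 10) / 3 * q' = (3 - sqrt 10) * (real_of_int p + (2 - sqrt 10) / 3 * q)"
    by (simp add: p'_def q'_def field_simps)
  moreover have "\<bar>3 - sqrt 10\<bar> \<le> 1"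
  proof -
    have "3 \<le> sqrt 10" "sqrt 10 \<le> 4" by (auto intro: real_le_rsqrt real_le_lsqrt)
    then show ?thesis by simp
  qed
  ultimately have "\<bar>real_of_int p' + (2 - sqrt 10) / 3 * q'\<bar> \<le> \<bar>real_of_int p + (2 - sqrt 10) / 3 * q\<bar>"
    by (simp add: abs_mult mult_left_le_one_le)
  moreover have "block p' q' e'" using block_step [OF b] by (simp add: p'_def q'_def e'_def)
  moreover have "p0 + int (Suc k) \<le> p'"
    using p state_pos [of z p q e] b unfolding block_def run_def p'_def by fastforce
  moreover have "3 * e' + p' - 2 * q' = 3 * e0 + p0 - 2 * q0"
    using v by (simp add: p'_def q'_def e'_def)
  ultimately show ?case using u by (meson order_trans)
qed

lemma no_block: "\<not> block p0 q0 e0"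
proof
  assume b0: "block p0 q0 e0"
  define \<gamma>\<^sub>0 where "\<gamma>\<^sub>0 = sqrt 10 - 5 / 2"
  define u0 where "u0 = \<bar>real_of_int p0 + (2 - sqrt 10) / 3 * q0\<bar>"
  define v0 where "v0 = real_of_int (3 * e0 + p0 - 2 * q0)"
  define C where "C = \<bar>- \<gamma>\<^sub>0 / 3 * v0\<bar> + \<bar>2 - 8 * \<gamma>\<^sub>0 / 3\<bar> * u0"
  have gap: "\<gamma> - \<gamma>\<^sub>0 > 0" using gamma by (simp add: \<gamma>\<^sub>0_def)
  \<comment> \<open>Since \<open>m\<close> will be at least \<open>p\<close>, this \<open>k\<close>
    pushes \<open>m\<close> past the bound reached at the end.\<close>
  obtain k :: nat where k: "(C + 2 * \<gamma>) / (\<gamma> - \<gamma>\<^sub>0) < k" using reals_Archimedean2 by blast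
  obtain p q e where b: "block p q e" and p: "p0 + int k \<le> p"
    and u: "\<bar>real_of_int p + (2 - sqrt 10) / 3 * q\<bar> \<le> u0"
    and v: "3 * e + p - 2 * q = 3 * e0 + p0 - 2 * q0"
    using blocks_bounded [OF b0, of k] unfolding u0_def by blast
  have v': "3 * real_of_int e + p - 2 * q = v0" using v unfolding v0_def by linarith
  \<comment> \<open>The last state of the block: its prefix repetition has distance
    \<open>2 * p + 3 * q\<close> and length \<open>m - 2\<close>, and along the blocks their ratio
    tends to \<open>sqrt 10 - 5 / 2\<close>.\<close>
  have st: "state z (p + 2 * q) (2 * p + 3 * q) (e + 2 * p + 2 * q) True False"
    and K_le: "K \<le> p + 2 * q"
    using b unfolding block_def run_def by auto
  have "state z p q e True False" "state z p0 q0 e0 True False"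
    using b b0 unfolding block_def run_def by auto
  note pos = state_pos [OF this(1)] state_pos [OF this(2)]
  define m where "m = real_of_int e + 3 * p + 4 * q"
  have "\<gamma> * (m - 2) \<le> 2 * real_of_int p + 3 * q"
    using state_repetitions(2) [OF late st] K_le K pos by (simp add: m_def algebra_simps)
  \<comment> \<open>\<open>sqrt 10 - 5 / 2\<close> is the value for which the dominant eigenvector does not contribute.\<close>
  moreover have "2 * real_of_int p + 3 * q - \<gamma>\<^sub>0 * m =
      - \<gamma>\<^sub>0 / 3 * (3 * real_of_int e + p - 2 * q) +
      (2 - 8 * \<gamma>\<^sub>0 / 3) * (real_of_int p + (2 - sqrt 10) / 3 * q)"
    by (simp add: m_def \<gamma>\<^sub>0_def field_simps)
  moreover have "(2 - 8 * \<gamma>\<^sub>0 / 3) * (real_of_int p + (2 - sqrt 10) / 3 * q) \<le> \<bar>2 - 8 * \<gamma>\<^sub>0 / 3\<bar> * u0"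
    by (rule order_trans [OF abs_ge_self]) (use u in \<open>simp add: abs_mult mult_left_mono\<close>)
  moreover have "- \<gamma>\<^sub>0 / 3 * v0 \<le> \<bar>- \<gamma>\<^sub>0 / 3 * v0\<bar>" by (rule abs_ge_self)
  ultimately have "\<gamma> * (m - 2) \<le> \<gamma>\<^sub>0 * m + C" unfolding v' C_def by linarith
  then have "(\<gamma> - \<gamma>\<^sub>0) * m \<le> C + 2 * \<gamma>" by (simp add: algebra_simps)
  then have "m \<le> (C + 2 * \<gamma>) / (\<gamma> - \<gamma>\<^sub>0)" using gap by (simp add: pos_le_divide_eq mult.commute)
  moreover have "real k \<le> m" using p pos by (simp add: m_def)
  ultimately show False using k by linarith
qed

end

theorem early_repetition:
  fixes z :: "int \<Rightarrow> 'a"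
  assumes "aperiodic z" "unique_right_special z" "a \<noteq> b" "range z \<subseteq> {a, b}"
    and "sqrt 10 - 5 / 2 < \<gamma>"
  shows "\<not> late_repetitions z \<gamma> n0"
proof
  assume "late_repetitions z \<gamma> n0"
  then interpret late_word z \<gamma> n0 using assms by unfold_locales
  show False using state_init [OF assms(3,4)] run_exists block_exists no_block by blast
qed

section \<open>Sturmian words\<close>

lemma factor_eq_iff: "factor x i n = factor y j n \<longleftrightarrow> (\<forall>k<n. x (i + k) = y (j + k))"
  by (auto simp: factor_def list_eq_iff_nth_eq)

lemma take_factor: "m \<le> n \<Longrightarrow> take m (factor x j n) = factor x j m"
  by (simp add: factor_def take_map)

definition factors :: "(nat \<Rightarrow> 'a) \<Rightarrow> nat \<Rightarrow> 'a list set" where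
  "factors x n = range (\<lambda>j. factor x j n)"

lemma complexity_eq_card: "complexity n x = card (factors x n)"
  unfolding complexity_def factors_def by (simp add: full_SetCompr_eq)

lemma finite_factors:
  assumes "finite (range x)"
  shows "finite (factors x n)"
proof (rule finite_subset)
  show "factors x n \<subseteq> {xs. set xs \<subseteq> range x \<and> length xs = n}"
    by (auto simp: factors_def factor_def)
  show "finite {xs. set xs \<subseteq> range x \<and> length xs = n}"
    using assms by (rule finite_lists_length_eq)
qed

lemma take_factors_Suc: "take n ` factors x (Suc n) = factors x n"
  by (auto simp: factors_def image_image take_factor)

definition eventually_periodic :: "(nat \<Rightarrow> 'a) \<Rightarrow> bool" where
  "eventually_periodic x \<longleftrightarrow> (\<exists>M p. 0 < p \<and> (\<forall>i\<ge>M. x (i + p) = x i))"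

lemma eventually_periodic_bounded:
  assumes "eventually_periodic x"
  shows "\<exists>B. \<forall>n. card (factors x n) \<le> B"
proof -
  obtain M p where p: "0 < p" and per: "\<And>i. i \<ge> M \<Longrightarrow> x (i + p) = x i"
    using assms unfolding eventually_periodic_def by blast
  have per': "x (i + k * p) = x i" if "i \<ge> M" for i k
  proof (induction k)
    case (Suc k)
    have "x (i + Suc k * p) = x (i + k * p + p)" by (simp add: algebra_simps)
    then show ?case using per [of "i + k * p"] that Suc by simp
  qed simp
  have "factors x n \<subseteq> (\<lambda>j. factor x j n) ` {..<M + p}" for n
  proof
    fix w assume "w \<in> factors x n"
    then obtain j where w: "w = factor x j n" by (auto simp: factors_def)
    show "w \<in> (\<lambda>j. factor x j n) ` {..<M + p}"
    proof (cases "j < M")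
      case True
      then show ?thesis using w by auto
    next
      case False
      define r where "r = M + (j - M) mod p"
      have j: "j = r + (j - M) div p * p" using False by (simp add: r_def)
      have "factor x j n = factor x r n"
        unfolding factor_eq_iff
      proof (intro allI impI)
        fix k
        have "x (j + k) = x (r + k + (j - M) div p * p)" using j by (metis add.commute add.left_commute)
        also have "\<dots> = x (r + k)" by (rule per') (simp add: r_def)
        finally show "x (j + k) = x (r + k)" .
      qed
      moreover have "r < M + p" using p by (simp add: r_def)
      ultimately show ?thesis using w by auto
    qed
  qed
  then have "card (factors x n) \<le> M + p" for n
    by (metis card_lessThan finite_lessThan surj_card_le)
  then show ?thesis by blast
qed

text \<open>The Morse--Hedlund argument: without growth, every factor determines its continuation.\<close>

lemma eventually_periodic_if_no_growth:
  assumes fin: "finite (range x)" and le: "card (factors x (Suc n)) \<le> card (factors x n)"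
  shows "eventually_periodic x"
proof -
  have "card (take n ` factors x (Suc n)) = card (factors x (Suc n))"
    using le card_image_le [OF finite_factors [OF fin], of "take n" "Suc n"]
    by (simp add: take_factors_Suc)
  then have inj: "inj_on (take n) (factors x (Suc n))"
    using eq_card_imp_inj_on finite_factors [OF fin] by blast
  have det: "x (i + n) = x (j + n)" if "factor x i n = factor x j n" for i j
  proof -
    have "factor x i (Suc n) = factor x j (Suc n)"
      by (rule inj_onD [OF inj]) (simp_all add: take_factor factors_def that)
    then show ?thesis by (simp add: factor_eq_iff)
  qed
  have "\<not> inj (\<lambda>j. factor x j n)"
    using finite_factors [OF fin, of n] finite_imageD unfolding factors_def by blast
  then obtain i j where "i \<noteq> j" "factor x i n = factor x j n" unfolding inj_on_def by blast
  then obtain i j where ij: "i < j" "factor x i n = factor x j n"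
    by (metis linorder_neqE_nat)
  have eq: "x (i + k) = x (j + k)" for k
  proof (induction k rule: less_induct)
    case (less k)
    show ?case
    proof (cases "k < n")
      case True
      then show ?thesis using ij(2) by (simp add: factor_eq_iff)
    next
      case False
      have "factor x (i + (k - n)) n = factor x (j + (k - n)) n"
        unfolding factor_eq_iff
      proof (intro allI impI)
        fix l assume "l < n"
        then show "x (i + (k - n) + l) = x (j + (k - n) + l)"
          using less [of "k - n + l"] False by (simp add: add.assoc)
      qed
      then show ?thesis using det [of "i + (k - n)" "j + (k - n)"] False by simp
    qed
  qed
  have "x (m + (j - i)) = x m" if "m \<ge> i" for m
    using eq [of "m - i"] that ij(1) by (simp add: add.commute)
  then show ?thesis unfolding eventually_periodic_def using ij(1) by (metis zero_less_diff)
qed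

section \<open>Sturmian words and their extension to the left\<close>

locale sturmian_word =
  fixes s :: "nat \<Rightarrow> 'a"
  assumes sturmian: "sturmian s"
begin

lemma finite_range: "finite (range s)"
  using sturmian by (simp add: sturmian_def)

lemma card_factors: "1 \<le> n \<Longrightarrow> card (factors s n) = n + 1"
  using sturmian by (simp add: sturmian_def complexity_eq_card)

lemma not_eventually_periodic: "\<not> eventually_periodic s"
proof
  assume "eventually_periodic s"
  then obtain B where B: "\<And>n. card (factors s n) \<le> B" using eventually_periodic_bounded by blast
  show False using B [of "Suc B"] card_factors [of "Suc B"] by simp
qed

text \<open>If a prefix did not recur, the shifted word would miss a factor of each length
  \<open>m > n\<close> and have at most \<open>m\<close> of them. By the Morse--Hedlund argument it
  would be eventually periodic, and so would \<open>s\<close>.\<close>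

lemma prefix_recurs: "\<exists>j\<ge>1. factor s j n = factor s 0 n"
proof (rule ccontr)
  assume neg: "\<not> ?thesis"
  define x where "x = (\<lambda>i. s (Suc i))"
  have fx: "factor x j m = factor s (Suc j) m" for j m by (simp add: factor_def x_def)
  have fin: "finite (range x)" using finite_range by (rule finite_subset [rotated]) (auto simp: x_def)
  have small: "card (factors x m) \<le> m" if "m \<ge> Suc n" for m
  proof -
    have "factor s (Suc j) m \<noteq> factor s 0 m" for j
    proof
      assume "factor s (Suc j) m = factor s 0 m"
      then have "factor s (Suc j) n = factor s 0 n"
        using that by (metis Suc_leD take_factor)
      then show False using neg by auto
    qed
    then have "factors x m \<subseteq> factors s m - {factor s 0 m}" by (auto simp: factors_def fx)
    then have "card (factors x m) \<le> card (factors s m - {factor s 0 m})"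
      using finite_factors [OF finite_range] by (intro card_mono) auto
    also have "\<dots> = m"
      using card_factors [of m] that by (subst card_Diff_singleton) (auto simp: factors_def)
    finally show ?thesis .
  qed
  have "m + 1 \<le> card (factors x m)" if grow: "\<And>m. card (factors x m) < card (factors x (Suc m))" for m
  proof (induction m)
    case 0
    then show ?case by (simp add: factors_def factor_def)
  next
    case (Suc m)
    then show ?case using grow [of m] by simp
  qed
  then obtain m where "card (factors x (Suc m)) \<le> card (factors x m)"
    using small [of "Suc n"] by (metis Suc_eq_plus1 not_less not_less_eq_eq order_refl order_trans)
  then have "eventually_periodic x" using eventually_periodic_if_no_growth fin by blast
  then obtain M p where "0 < p" "\<forall>i\<ge>M. s (Suc (i + p)) = s (Suc i)"
    unfolding eventually_periodic_def x_def by blast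
  then have "s (i + p) = s i" if "i \<ge> Suc M" for i
    using that by (metis Suc_le_D Suc_le_mono add_Suc)
  then show False using not_eventually_periodic \<open>0 < p\<close> unfolding eventually_periodic_def by blast
qed

definition extends :: "(nat \<Rightarrow> 'a) \<Rightarrow> bool" where
  "extends y \<longleftrightarrow> (\<forall>n. \<exists>j. factor s j n = factor y 0 n)"

text \<open>Compactness: if each letter \<open>c\<close> failed at a length \<open>f c\<close>, take
  the maximum \<open>n\<close> over the finitely many letters. The letter before an occurrence of
  the prefix of \<open>y\<close> of length \<open>n\<close> does not fail; recurrence supplies an
  occurrence away from position 0.\<close>

lemma extends_left:
  assumes "extends y"
  shows "\<exists>c. extends (case_nat c y)"
proof (rule ccontr)
  assume "\<not> ?thesis"
  then have "\<forall>c. \<exists>n. \<forall>j. factor s j n \<noteq> factor (case_nat c y) 0 n" unfolding extends_def by blast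
  then obtain f where f: "\<And>c j. factor s j (f c) \<noteq> factor (case_nat c y) 0 (f c)" by metis
  define n where "n = Max (f ` range s)"
  have f_le: "f (s i) \<le> n" for i unfolding n_def using finite_range by (intro Max_ge) auto
  obtain j where "factor s j n = factor y 0 n" using assms unfolding extends_def by blast
  moreover have "\<exists>j\<ge>1. factor s j n = factor s 0 n" by (rule prefix_recurs)
  ultimately obtain j where j: "factor s (Suc j) n = factor y 0 n"
    by (metis One_nat_def Suc_le_D not0_implies_Suc)
  have "s (j + k) = case_nat (s j) y k" if "k < Suc n" for k
    using j that by (cases k) (auto simp: factor_eq_iff)
  then have "factor s j (f (s j)) = factor (case_nat (s j) y) 0 (f (s j))"
    using f_le [of j] by (auto simp: factor_eq_iff)
  then show False using f by blast
qed

lemma two_sided_extension: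
  obtains z :: "int \<Rightarrow> 'a" where "\<And>i. z (int i) = s i"
    and "\<And>i n. \<exists>j. \<forall>k<n. z (i + int k) = s (j + k)"
proof -
  \<comment> \<open>\<open>ys n\<close> will be the part of \<open>z\<close> that begins at position
    \<open>- n\<close>.\<close>
  have "\<exists>ys. \<forall>n. (extends (ys n) \<and> (n = 0 \<longrightarrow> ys n = s)) \<and> (\<forall>i. ys (Suc n) (Suc i) = ys n i)"
  proof (rule dependent_nat_choice)
    show "\<exists>x. extends x \<and> (0 = 0 \<longrightarrow> x = s)" by (auto simp: extends_def)
  next
    fix y and n :: nat assume "extends y \<and> (n = 0 \<longrightarrow> y = s)"
    then obtain c where "extends (case_nat c y)" using extends_left by blast
    then show "\<exists>y'. (extends y' \<and> (Suc n = 0 \<longrightarrow> y' = s)) \<and> (\<forall>i. y' (Suc i) = y i)"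
      by (intro exI [of _ "case_nat c y"]) auto
  qed
  then obtain ys where ext: "\<And>n. extends (ys n)" and ys0: "ys 0 = s"
    and ys: "\<And>n i. ys (Suc n) (Suc i) = ys n i" by metis
  have shift: "ys (m + k) (i + k) = ys m i" for m k i by (induction k) (auto simp: ys)
  define z where "z i = (if 0 \<le> i then s (nat i) else ys (nat (- i)) 0)" for i
  have z_ys: "z (int i - int n) = ys n i" for i n
  proof (cases "n \<le> i")
    case True
    then show ?thesis using shift [of 0 n "i - n"] by (simp add: z_def ys0 nat_diff_distrib)
  next
    case False
    then show ?thesis using shift [of "n - i" i 0] by (simp add: z_def nat_diff_distrib)
  qed
  have "\<exists>j. \<forall>k<n. z (i + int k) = s (j + k)" for i n
  proof -
    \<comment> \<open>\<open>d\<close> is the offset of position \<open>i\<close> in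
      \<open>ys M\<close>, whose first \<open>d + n\<close> letters cover the window.\<close>
    define M where "M = nat (- i)"
    define d where "d = nat (i + int M)"
    have d: "int d - int M = i" by (auto simp: d_def M_def)
    obtain j where "factor s j (d + n) = factor (ys M) 0 (d + n)"
      using ext unfolding extends_def by blast
    then have *: "s (j + k) = ys M k" if "k < d + n" for k using that by (simp add: factor_eq_iff)
    have "z (i + int k) = s (j + d + k)" if "k < n" for k
    proof -
      have "z (i + int k) = z (int (d + k) - int M)" using d by (simp add: algebra_simps)
      also have "\<dots> = s (j + d + k)" using z_ys [of "d + k" M] * [of "d + k"] that by (simp add: add.assoc)
      finally show ?thesis .
    qed
    then show ?thesis by blast
  qed
  then show thesis using that [of z] by (simp add: z_def)
qed

lemma unique_right_special_factor:
  assumes "0 < n" and "factor s i n = factor s i' n" "s (i + n) \<noteq> s (i' + n)"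
    and "factor s j n = factor s j' n" "s (j + n) \<noteq> s (j' + n)"
  shows "factor s i n = factor s j n"
proof (rule ccontr)
  assume neq: "factor s i n \<noteq> factor s j n"
  \<comment> \<open>Without one extension of each of the two right special factors, every factor of
    length \<open>n\<close> still has an extension in \<open>W\<close>. But \<open>W\<close> has
    only \<open>n\<close> elements for \<open>n + 1\<close> factors.\<close>
  define W where "W = factors s (Suc n) - {factor s i (Suc n), factor s j (Suc n)}"
  have mem: "factor s k (Suc n) \<in> factors s (Suc n)" for k by (simp add: factors_def)
  have tk: "take n (factor s k (Suc n)) = factor s k n" for k by (simp add: take_factor)
  have ne: "factor s i' (Suc n) \<noteq> factor s i (Suc n)" "factor s j' (Suc n) \<noteq> factor s j (Suc n)"
    using assms by (auto simp: factor_eq_iff)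
  have ne': "factor s i' (Suc n) \<noteq> factor s j (Suc n)" "factor s j' (Suc n) \<noteq> factor s i (Suc n)"
    "factor s i (Suc n) \<noteq> factor s j (Suc n)"
    using neq assms(2,4) tk by metis+
  have "factors s n \<subseteq> take n ` W"
  proof
    fix w assume "w \<in> factors s n"
    then obtain k where w: "w = factor s k n" by (auto simp: factors_def)
    consider "factor s k (Suc n) = factor s i (Suc n)" | "factor s k (Suc n) = factor s j (Suc n)"
      | "factor s k (Suc n) \<in> W" using mem [of k] by (auto simp: W_def)
    then show "w \<in> take n ` W"
    proof cases
      case 1
      then have "w = take n (factor s i' (Suc n))" using w tk assms(2) by metis
      then show ?thesis using mem ne ne' by (auto simp: W_def)
    next
      case 2
      then have "w = take n (factor s j' (Suc n))" using w tk assms(4) by metis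
      then show ?thesis using mem ne ne' by (auto simp: W_def)
    next
      case 3
      then show ?thesis using w tk by (metis image_eqI)
    qed
  qed
  moreover have fin: "finite W" using finite_factors [OF finite_range] by (simp add: W_def)
  ultimately have "card (factors s n) \<le> card W" using surj_card_le by blast
  also have "card W = n"
    unfolding W_def using ne' mem finite_factors [OF finite_range] card_factors [of "Suc n"]
    by (subst card_Diff_subset) auto
  finally show False using card_factors [of n] assms(1) by simp
qed

end

section \<open>Transfer of the bound to \<open>rep\<close>\<close>

lemma rep_fun_le:
  assumes "factor x j n = factor x (j + d) n" "0 < d"
  shows "rep_fun n x \<le> n + j + d"
  unfolding rep_fun_def
  \<comment> \<open>\<open>rep_fun\<close> counts its index from 1, so position \<open>j\<close>
    becomes \<open>Suc j\<close>.\<close>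
  by (rule Least_le) (use assms in \<open>auto intro!: exI [of _ "Suc j"] simp: add.assoc\<close>)

theorem theorem3p4:
  fixes s :: "nat \<Rightarrow> 'a"
  assumes "sturmian s"
  shows "rep s \<le> ereal (sqrt 10 - 3 / 2)"
proof (rule ccontr)
  interpret sturmian_word s using assms by unfold_locales
  assume "\<not> rep s \<le> ereal (sqrt 10 - 3 / 2)"
  then obtain c where c: "sqrt 10 - 3 / 2 < c" "ereal c < rep s"
    by (metis ereal_dense2 ereal_less_eq(3) less_ereal.simps(1) not_le)
  have "\<forall>\<^sub>F n in sequentially. ereal c < ereal (real (rep_fun n s) / real n)"
    using c(2) unfolding rep_def by (rule less_LiminfD)
  then obtain n0 where n0: "\<And>n. n \<ge> n0 \<Longrightarrow> c < real (rep_fun n s) / real n"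
    unfolding eventually_sequentially by auto
  obtain z where zs: "\<And>i. z (int i) = s i"
    and fac: "\<And>i n. \<exists>j. \<forall>k<n. z (i + int k) = s (j + k)"
    using two_sided_extension by blast
  have "card (range s) = 2"
  proof -
    have "factors s 1 = (\<lambda>c. [c]) ` range s" by (auto simp: factors_def factor_def)
    moreover have "card ((\<lambda>c. [c]) ` range s) = card (range s)"
      by (rule card_image) (simp add: inj_on_def)
    ultimately show ?thesis using card_factors [of 1] by simp
  qed
  then obtain a b where ab: "a \<noteq> b" "range s = {a, b}" by (metis card_2_iff)
  have "range z \<subseteq> {a, b}"
  proof
    fix c assume "c \<in> range z"
    then obtain i where "c = z i" by auto
    moreover obtain j where "\<forall>k<1. z (i + int k) = s (j + k)" using fac by blast
    ultimately have "c = s j" by simp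
    then show "c \<in> {a, b}" using ab by blast
  qed
  moreover have "aperiodic z"
    unfolding aperiodic_def
  proof (rule ccontr)
    assume "\<not> (\<forall>M p. 0 < p \<longrightarrow> (\<exists>i\<ge>M. z (i + p) \<noteq> z i))"
    then obtain M p where p: "0 < p" "\<And>i. i \<ge> M \<Longrightarrow> z (i + p) = z i" by blast
    have "s (i + nat p) = s i" if "i \<ge> nat M" for i
      using p(2) [of "int i"] that p(1) zs [of i] zs [of "i + nat p"] by simp
    then show False
      using not_eventually_periodic p(1) unfolding eventually_periodic_def by (metis zero_less_nat_eq)
  qed
  moreover have "unique_right_special z"
    unfolding unique_right_special_def
  proof (intro allI impI)
    fix n i i' j j' k :: int
    assume n: "0 < n"
      and eqi: "\<forall>k. 0 \<le> k \<and> k < n \<longrightarrow> z (i + k) = z (i' + k)" and nei: "z (i + n) \<noteq> z (i' + n)"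
      and eqj: "\<forall>k. 0 \<le> k \<and> k < n \<longrightarrow> z (j + k) = z (j' + k)" and nej: "z (j + n) \<noteq> z (j' + n)"
      and k: "0 \<le> k \<and> k < n"
    define m where "m = nat n"
    have m: "int m = n" "0 < m" using n by (auto simp: m_def)
    have "\<exists>j. \<forall>k\<le>m. z (i + int k) = s (j + k)" for i
      using fac [of "Suc m" i] by (simp add: less_Suc_eq_le)
    \<comment> \<open>\<open>g i\<close> is a place in \<open>s\<close> where the
      \<open>m + 1\<close> letters of \<open>z\<close> from \<open>i\<close> on occur; the extra
      letter carries right speciality over to \<open>s\<close>.\<close>
    then obtain g where g: "\<And>i k. k \<le> m \<Longrightarrow> z (i + int k) = s (g i + k)" by metis
    have fe: "factor s (g i) m = factor s (g i') m \<longleftrightarrow> (\<forall>k. 0 \<le> k \<and> k < n \<longrightarrow> z (i + k) = z (i' + k))"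
      for i i'
    proof -
      have "factor s (g i) m = factor s (g i') m \<longleftrightarrow> (\<forall>k<m. z (i + int k) = z (i' + int k))"
        by (simp add: factor_eq_iff g)
      also have "\<dots> \<longleftrightarrow> (\<forall>k. 0 \<le> k \<and> k < n \<longrightarrow> z (i + k) = z (i' + k))"
        unfolding m(1) [symmetric] by (metis of_nat_less_iff of_nat_0_le_iff zero_le_imp_eq_int)
      finally show ?thesis .
    qed
    have "factor s (g i) m = factor s (g j) m"
      using unique_right_special_factor [of m "g i" "g i'" "g j" "g j'"] m eqi nei eqj nej
        g [of m] fe by simp
    then show "z (i + k) = z (j + k)" using fe k by blast
  qed
  \<comment> \<open>A repetition at \<open>j\<close> with distance \<open>d\<close> gives
    \<open>rep_fun n s <= n + j + d\<close>, so the factor \<open>c\<close> for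
    \<open>rep_fun\<close> becomes \<open>c - 1\<close> for \<open>j + d\<close>. The maximum with 1
    keeps \<open>n\<close> positive.\<close>
  moreover have "late_repetitions z (c - 1) (int (max 1 n0))"
    unfolding late_repetitions_def
  proof (intro allI impI)
    fix j d n :: int
    assume jd: "0 \<le> j" "0 < d" and n: "int (max 1 n0) \<le> n"
      and eq: "\<forall>k. 0 \<le> k \<and> k < n \<longrightarrow> z (j + k) = z (j + d + k)"
    define j' d' n' where "j' = nat j" and "d' = nat d" and "n' = nat n"
    have nat: "j = int j'" "d = int d'" "n = int n'" using jd n by (auto simp: j'_def d'_def n'_def)
    have "factor s j' n' = factor s (j' + d') n'"
      unfolding factor_eq_iff
    proof (intro allI impI)
      fix k assume "k < n'"
      then have "z (int (j' + k)) = z (int (j' + d' + k))"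
        using eq [rule_format, of "int k"] by (simp add: nat)
      then show "s (j' + k) = s (j' + d' + k)" by (simp only: zs)
    qed
    then have "rep_fun n' s \<le> n' + j' + d'" using rep_fun_le jd(2) nat by fastforce
    moreover have "c < real (rep_fun n' s) / real n'" "0 < n'" using n0 [of n'] n nat by auto
    then have "c * real n' < real (rep_fun n' s)" by (simp add: pos_less_divide_eq)
    ultimately show "(c - 1) * real_of_int n \<le> real_of_int (j + d)"
      by (simp add: nat algebra_simps)
  qed
  ultimately show False using early_repetition [of z a b "c - 1"] ab(1) c(1) by auto
qed

end
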